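(* Let $m<n$, let $A\in\mathbb{R}^{m\times n}$ have full row rank, let $C\in\mathbb{R}^{n\times n}$ be symmetric positive definite, and let $B\in\mathbb{R}^{n\times n}$ satisfy $C^{-1}=B^{T}B$. Let $$A = U\begin{bmatrix} 0_{m,n-m} & \Sigma_A\end{bmatrix}X^{-1},\qquad B = V\begin{bmatrix} I_{n-m} & 0\\ 0 & \Sigma_B\end{bmatrix}X^{-1}$$ be a generalized singular value decomposition of the pair $(A,B)$, and partition the invertible matrix $X\in\mathbb{R}^{n\times n}$ as $$X=\begin{bmatrix} X' & X''\end{bmatrix},\qquad X'\in\mathbb{R}^{n\times(n-m)},\quad X''\in\mathbb{R}^{n\times m}.$$ Then $$\mathscr{N}(A)=\operatorname{span}\{X'\},$$ and $\mathbb{R}^n$ is the $C$-orthogonal direct sum $$\mathbb{R}^n=\operatorname{span}\{X'\}\oplus_C\operatorname{span}\{X''\}=\mathscr{N}(A)\oplus_C\operatorname{span}\{X''\}.$$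
   Context: Generalized singular value decomposition (GSVD): for a matrix pair $(A,B)$ with $A\in\mathbb{R}^{m\times n}$, $B\in\mathbb{R}^{n\times n}$, $m<n$, a GSVD is a factorization $$A = U\begin{bmatrix} 0_{m,n-m} & \Sigma_A\end{bmatrix}X^{-1},\qquad B = V\begin{bmatrix} I_{n-m} & 0\\ 0 & \Sigma_B\end{bmatrix}X^{-1},$$ where $U\in\mathbb{R}^{m\times m}$ and $V\in\mathbb{R}^{n\times n}$ are orthogonal, $X\in\mathbb{R}^{n\times n}$ is invertible, and $\Sigma_A,\Sigma_B\in\mathbb{R}^{m\times m}$ are diagonal with real nonnegative diagonal entries $s^{(A)}_1\le\dots\le s^{(A)}_m$ and $s^{(B)}_1\ge\dots\ge s^{(B)}_m$, respectively, satisfying $(s^{(A)}_j)^2+(s^{(B)}_j)^2=1$ for $1\le j\le m$. When $A$ has full row rank, the diagonal entries of $\Sigma_A$ are positive. Notation: $\mathscr{N}(A)$ is the null space of $A$. For a matrix $Y$, $\operatorname{span}(Y)=\operatorname{span}\{Y\}$ denotes the subspace spanned by the columns of $Y$. For a symmetric positive definite matrix $C$, the $C$-inner product is $\langle x,y\rangle_C=x^{T}C^{-1}y$ (note the inverse of $C$). Vectors $x,y$ are $C$-orthogonal, $x\perp_C y$, if $\langle x,y\rangle_C=0$. The notation $\oplus_C$ denotes a direct sum of two subspaces that are mutually $C$-orthogonal, i.e. $x\perp_C y$ for every $x$ in the first subspace and every $y$ in the second. *)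

theory Defs
  imports
    Complex_Main
    "Jordan_Normal_Form.Matrix"
    "Jordan_Normal_Form.Gauss_Jordan_Elimination"
    "Jordan_Normal_Form.VS_Connect"
    "Jordan_Normal_Form.Matrix_Kernel"
    "Jordan_Normal_Form.DL_Rank"
begin

(* mat_inverse returns None on non-invertible input, so inv_mat is only meaningful for
   invertible matrices. *)
definition inv_mat :: "real mat \<Rightarrow> real mat" where
  "inv_mat M = the (mat_inverse M)"

definition append_cols :: "real mat \<Rightarrow> real mat \<Rightarrow> real mat" where
  "append_cols M N = four_block_mat M N (0\<^sub>m 0 (dim_col M)) (0\<^sub>m 0 (dim_col N))"

(* The library's orthogonal_mat only asks for pairwise orthogonal nonzero columns; here the
   columns must be orthonormal. *)
definition is_orthogonal :: "real mat \<Rightarrow> bool" where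
  "is_orthogonal Q \<longleftrightarrow> square_mat Q \<and> inverts_mat (transpose_mat Q) Q \<and> inverts_mat Q (transpose_mat Q)"

definition sym_pos_def :: "nat \<Rightarrow> real mat \<Rightarrow> bool" where
  "sym_pos_def n C \<longleftrightarrow> C \<in> carrier_mat n n \<and> transpose_mat C = C \<and>
     (\<forall>x \<in> carrier_vec n. x \<noteq> 0\<^sub>v n \<longrightarrow> x \<bullet> (C *\<^sub>v x) > 0)"

(* Note the inverse of C: this is the inner product x^T C^{-1} y. *)
definition C_inner :: "real mat \<Rightarrow> real vec \<Rightarrow> real vec \<Rightarrow> real" where
  "C_inner C x y = x \<bullet> (inv_mat C *\<^sub>v y)"

definition C_orthogonal :: "real mat \<Rightarrow> real vec \<Rightarrow> real vec \<Rightarrow> bool" where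
  "C_orthogonal C x y \<longleftrightarrow> C_inner C x y = 0"

(* W is the direct sum, inside R^n, of the mutually C-orthogonal subspaces W1 and W2. *)
definition C_direct_sum ::
  "nat \<Rightarrow> real mat \<Rightarrow> real vec set \<Rightarrow> real vec set \<Rightarrow> real vec set \<Rightarrow> bool" where
  "C_direct_sum n C W W1 W2 \<longleftrightarrow>
     subspace class_ring W1 (module_vec TYPE(real) n) \<and>
     subspace class_ring W2 (module_vec TYPE(real) n) \<and>
     W = module.submodule_sum (module_vec TYPE(real) n) W1 W2 \<and>
     W1 \<inter> W2 = {0\<^sub>v n} \<and>
     (\<forall>x \<in> W1. \<forall>y \<in> W2. C_orthogonal C x y)"

(* Matrix indices are 0-based. Positivity of the entries of SA is not part of the definition; it is a
   consequence of A having full row rank. *)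
definition is_gsvd ::
  "nat \<Rightarrow> nat \<Rightarrow> real mat \<Rightarrow> real mat \<Rightarrow> real mat \<Rightarrow> real mat \<Rightarrow> real mat \<Rightarrow> real mat \<Rightarrow> real mat \<Rightarrow> bool"
where
  "is_gsvd m n A B U V SA SB X \<longleftrightarrow>
     m < n \<and>
     A \<in> carrier_mat m n \<and> B \<in> carrier_mat n n \<and>
     U \<in> carrier_mat m m \<and> is_orthogonal U \<and>
     V \<in> carrier_mat n n \<and> is_orthogonal V \<and>
     X \<in> carrier_mat n n \<and> invertible_mat X \<and>
     SA \<in> carrier_mat m m \<and> diagonal_mat SA \<and>
     SB \<in> carrier_mat m m \<and> diagonal_mat SB \<and>
     (\<forall>j < m. 0 \<le> SA $$ (j,j) \<and> 0 \<le> SB $$ (j,j)) \<and>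
     (\<forall>i j. i \<le> j \<longrightarrow> j < m \<longrightarrow> SA $$ (i,i) \<le> SA $$ (j,j) \<and> SB $$ (j,j) \<le> SB $$ (i,i)) \<and>
     (\<forall>j < m. (SA $$ (j,j))\<^sup>2 + (SB $$ (j,j))\<^sup>2 = 1) \<and>
     A = U * append_cols (0\<^sub>m m (n - m)) SA * inv_mat X \<and>
     B = V * four_block_mat (1\<^sub>m (n - m)) (0\<^sub>m (n - m) m) (0\<^sub>m m (n - m)) SB * inv_mat X"

end

theory Submission
  imports Defs
begin

text \<open>
  In the coordinates given by the columns of \<open>X\<close> we have
  \<open>A X (u, w) = U \<Sigma>\<^sub>A w\<close> and \<open>B X (u, w) = V (u, \<Sigma>\<^sub>B w)\<close>. Full row rank makes \<open>A\<close> surjective,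
  which forces the diagonal of \<open>\<Sigma>\<^sub>A\<close> to be nonzero, so the kernel of \<open>A\<close> is \<open>w = 0\<close>.
  The \<open>C\<close>-inner product is the Euclidean inner product of the images under \<open>B\<close>, and
  \<open>V (u, 0)\<close> is perpendicular to \<open>V (0, \<Sigma>\<^sub>B w)\<close> because \<open>V\<close> is orthogonal.
\<close>

section \<open>Inverses, block columns, diagonal and orthogonal matrices\<close>

lemma inv_mat_inverse:
  assumes "M \<in> carrier_mat n n" and "invertible_mat M"
  shows "inv_mat M \<in> carrier_mat n n" "M * inv_mat M = 1\<^sub>m n" "inv_mat M * M = 1\<^sub>m n"
proof -
  obtain N where N: "M * N = 1\<^sub>m n" "N * M = 1\<^sub>m (dim_row N)"
    using assms unfolding invertible_mat_def inverts_mat_def by auto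
  \<comment> \<open>\<open>inverts_mat\<close> does not fix the size of \<open>N\<close>; comparing
    column counts in the two product identities shows that it is n by n. Then \<open>M\<close> is a
    unit of the matrix ring, which rules out \<open>None\<close> as the value of
    \<open>mat_inverse\<close>.\<close>
  have "dim_col N = n" using arg_cong[OF N(1), of dim_col] by simp
  moreover have "dim_row N = n" using arg_cong[OF N(2), of dim_col] assms by simp
  ultimately have "M \<in> Units (ring_mat TYPE(real) n ())"
    using N assms(1) unfolding Units_def ring_mat_def by auto
  then obtain Y where Y: "mat_inverse M = Some Y"
    using mat_inverse(1)[OF assms(1)] by fastforce
  show "inv_mat M \<in> carrier_mat n n" "M * inv_mat M = 1\<^sub>m n" "inv_mat M * M = 1\<^sub>m n"
    using mat_inverse(2)[OF assms(1) Y] Y by (simp_all add: inv_mat_def)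
qed

lemma mult_mat_zero_vec:
  fixes M :: "real mat"
  assumes "M \<in> carrier_mat r k"
  shows "M *\<^sub>v 0\<^sub>v k = 0\<^sub>v r"
  using assms by auto

lemma append_cols_carrier:
  assumes "M \<in> carrier_mat r k" and "N \<in> carrier_mat r l"
  shows "append_cols M N \<in> carrier_mat r (k + l)"
  using assms by (auto simp: append_cols_def)

lemma append_cols_mult_append_vec:
  assumes "M \<in> carrier_mat r k" and "N \<in> carrier_mat r l"
    and "u \<in> carrier_vec k" and "w \<in> carrier_vec l"
  shows "append_cols M N *\<^sub>v (u @\<^sub>v w) = M *\<^sub>v u + N *\<^sub>v w"
proof -
  have "append_cols M N *\<^sub>v (u @\<^sub>v w)
      = (M *\<^sub>v u + N *\<^sub>v w) @\<^sub>v (0\<^sub>m 0 k *\<^sub>v u + 0\<^sub>m 0 l *\<^sub>v w)"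
    using four_block_mat_mult_vec[OF assms(1,2) zero_carrier_mat zero_carrier_mat assms(3,4)]
      assms(1,2) by (simp add: append_cols_def)
  \<comment> \<open>The lower blocks have no rows, so the appended second part has length 0.\<close>
  also have "\<dots> = M *\<^sub>v u + N *\<^sub>v w"
    using assms by (intro eq_vecI) auto
  finally show ?thesis .
qed

lemma diagonal_mult_vec_index:
  fixes D :: "real mat"
  assumes "D \<in> carrier_mat k k" and "diagonal_mat D" and "w \<in> carrier_vec k" and "j < k"
  shows "(D *\<^sub>v w) $ j = D $$ (j, j) * w $ j"
proof -
  have "(D *\<^sub>v w) $ j = (\<Sum>i\<in>{0..<k}. D $$ (j, i) * w $ i)"
    using assms by (auto simp: scalar_prod_def intro!: sum.cong)
  also have "\<dots> = (\<Sum>i\<in>{0..<k}. if i = j then D $$ (j, j) * w $ j else 0)"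
    using assms unfolding diagonal_mat_def by (intro sum.cong) auto
  finally show ?thesis using assms by simp
qed

lemma is_orthogonal_transpose_mult:
  assumes "Q \<in> carrier_mat k k" and "is_orthogonal Q"
  shows "transpose_mat Q * Q = 1\<^sub>m k"
  using assms unfolding is_orthogonal_def inverts_mat_def by simp

lemma is_orthogonal_mult_vec_cancel:
  assumes "Q \<in> carrier_mat k k" and "is_orthogonal Q" and "x \<in> carrier_vec k"
  shows "transpose_mat Q *\<^sub>v (Q *\<^sub>v x) = x"
  using assms is_orthogonal_transpose_mult[OF assms(1,2)]
  by (metis assoc_mult_mat_vec one_mult_mat_vec transpose_carrier_mat)

lemma is_orthogonal_scalar_prod:
  assumes "Q \<in> carrier_mat k k" and "is_orthogonal Q"
    and "x \<in> carrier_vec k" and "y \<in> carrier_vec k"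
  shows "(Q *\<^sub>v x) \<bullet> (Q *\<^sub>v y) = x \<bullet> y"
proof -
  have "(Q *\<^sub>v x) \<bullet> (Q *\<^sub>v y) = (transpose_mat Q *\<^sub>v (Q *\<^sub>v x)) \<bullet> y"
    by (rule transpose_vec_mult_scalar[symmetric]) (use assms in auto)
  then show ?thesis using is_orthogonal_mult_vec_cancel[OF assms(1-3)] by simp
qed

section \<open>Column spaces and sums of subspaces\<close>

lemma (in vec_space) mem_col_space_iff:
  assumes "A \<in> carrier_mat n k"
  shows "y \<in> col_space A \<longleftrightarrow> (\<exists>u \<in> carrier_vec k. y = A *\<^sub>v u)"
  using assms by (auto simp: col_space_eq[OF assms])

lemma (in vec_space) col_space_is_subspace:
  assumes "A \<in> carrier_mat n k"
  shows "subspace class_ring (col_space A) V"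
  unfolding col_space_def
  using span_is_subspace cols_dim assms by (metis carrier_matD(1))

text \<open>The rank is the size of a maximal independent set of columns. If it equals the dimension
  \<open>n\<close>, that set is a basis of the whole space, and its span lies inside the column
  space.\<close>

lemma (in vec_space) full_rank_col_space:
  assumes A: "A \<in> carrier_mat n k" and "rank A = n"
  shows "col_space A = carrier_vec n"
proof -
  have cols: "set (cols A) \<subseteq> carrier_vec n" using cols_dim A by blast
  \<comment> \<open>The empty set is independent and serves as the seed that is enlarged to a
    maximal independent subset.\<close>
  obtain S where S: "maximal S (\<lambda>T. T \<subseteq> set (cols A) \<and> lin_indpt T)" "finite S"
    using maximal_exists_superset[of "set (cols A)" "\<lambda>T. T \<subseteq> set (cols A) \<and> lin_indpt T" "{}"]
    by (auto simp: lin_dep_def)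
  have sub: "S \<subseteq> set (cols A)" "lin_indpt S" using S(1) unfolding maximal_def by auto
  have "card S = n" using rank_card_indpt[OF A S(1)] assms(2) by simp
  then have "basis S"
    using dim_li_is_basis[OF fin_dim S(2)] sub cols dim_is_n by auto
  then have "carrier_vec n \<subseteq> col_space A"
    using span_is_monotone[OF sub(1)] unfolding basis_def col_space_def by simp
  moreover have "col_space A \<subseteq> carrier_vec n"
    unfolding col_space_def using cols span_is_subset2 by simp
  ultimately show ?thesis by simp
qed

lemma (in vec_space) submodule_sum_eq:
  "submodule_sum W1 W2 = {x + y |x y. x \<in> W1 \<and> y \<in> W2}"
  unfolding submodule_sum_def by (auto simp: image_def)

section \<open>The pair (A, B) in the coordinates given by X\<close>

lemma gsvd_mult_vec:
  assumes "is_gsvd m n A B U V SA SB X"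
    and "u \<in> carrier_vec (n - m)" and "w \<in> carrier_vec m"
  shows "A *\<^sub>v (X *\<^sub>v (u @\<^sub>v w)) = U *\<^sub>v (SA *\<^sub>v w)"
    and "B *\<^sub>v (X *\<^sub>v (u @\<^sub>v w)) = V *\<^sub>v (u @\<^sub>v (SB *\<^sub>v w))"
proof -
  note g = assms(1)[unfolded is_gsvd_def]
  have mn: "n - m + m = n" using g by simp
  have uw: "u @\<^sub>v w \<in> carrier_vec n" using append_carrier_vec[OF assms(2,3)] mn by simp
  have X: "X \<in> carrier_mat n n" "invertible_mat X" using g by auto
  note Y = inv_mat_inverse[OF X]
  \<comment> \<open>The row count \<open>r\<close> is left open because the cancellation of
    \<open>inv_mat X\<close> against \<open>X\<close> is used twice: with \<open>r = m\<close> for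
    \<open>A\<close> and with \<open>r = n\<close> for \<open>B\<close>.\<close>
  have factor: "P * D * inv_mat X *\<^sub>v (X *\<^sub>v (u @\<^sub>v w)) = P *\<^sub>v (D *\<^sub>v (u @\<^sub>v w))"
    if "P \<in> carrier_mat r r" "D \<in> carrier_mat r n" for r and P D :: "real mat"
  proof -
    have "inv_mat X *\<^sub>v (X *\<^sub>v (u @\<^sub>v w)) = u @\<^sub>v w"
      using assoc_mult_mat_vec[OF Y(1) X(1) uw] Y(3) uw by simp
    then show ?thesis using that Y(1) X(1) uw
      by (smt (verit) assoc_mult_mat_vec mult_carrier_mat mult_mat_vec_carrier)
  qed
  have "append_cols (0\<^sub>m m (n - m)) SA *\<^sub>v (u @\<^sub>v w) = SA *\<^sub>v w"
    using append_cols_mult_append_vec[of "0\<^sub>m m (n - m)" m "n - m" SA m u w] g assms(2,3) by auto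
  moreover have "append_cols (0\<^sub>m m (n - m)) SA \<in> carrier_mat m n"
    using append_cols_carrier[of "0\<^sub>m m (n - m)" m "n - m" SA m] g mn by auto
  ultimately show "A *\<^sub>v (X *\<^sub>v (u @\<^sub>v w)) = U *\<^sub>v (SA *\<^sub>v w)"
    using factor[of U m "append_cols (0\<^sub>m m (n - m)) SA"] g by metis
  let ?D = "four_block_mat (1\<^sub>m (n - m)) (0\<^sub>m (n - m) m) (0\<^sub>m m (n - m)) SB"
  have SB: "SB \<in> carrier_mat m m" using g by blast
  have "?D *\<^sub>v (u @\<^sub>v w) = u @\<^sub>v (SB *\<^sub>v w)"
    by (subst four_block_mat_mult_vec[OF one_carrier_mat zero_carrier_mat zero_carrier_mat SB
          assms(2,3)])
      (use SB assms(2,3) in auto)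
  moreover have "?D \<in> carrier_mat n n"
    using four_block_carrier_mat[OF one_carrier_mat[of "n - m"] SB] mn by simp
  ultimately show "B *\<^sub>v (X *\<^sub>v (u @\<^sub>v w)) = V *\<^sub>v (u @\<^sub>v (SB *\<^sub>v w))"
    using factor[of V n ?D] g by metis
qed

lemma gsvd_coordinates:
  assumes "is_gsvd m n A B U V SA SB X" and "x \<in> carrier_vec n"
  obtains u w where "u \<in> carrier_vec (n - m)" "w \<in> carrier_vec m" "x = X *\<^sub>v (u @\<^sub>v w)"
proof -
  have X: "X \<in> carrier_mat n n" "invertible_mat X" and mn: "n - m + m = n"
    using assms(1) unfolding is_gsvd_def by auto
  note Y = inv_mat_inverse[OF X]
  define z where "z = inv_mat X *\<^sub>v x"
  \<comment> \<open>The length is written as a sum so that the first \<open>n - m\<close> and the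
    last \<open>m\<close> entries of \<open>z\<close> reassemble to \<open>z\<close>. Subtraction on
    naturals truncates, so \<open>n - m + m = n\<close> rests on \<open>m < n\<close>.\<close>
  have "z \<in> carrier_vec (n - m + m)" using Y(1) assms(2) mn by (auto simp: z_def)
  moreover have "x = X *\<^sub>v z"
    unfolding z_def using assoc_mult_mat_vec[OF X(1) Y(1) assms(2)] Y(2) assms(2) by simp
  ultimately show ?thesis
    using that[of "vec_first z (n - m)" "vec_last z m"] by simp
qed

text \<open>Surjectivity of \<open>A\<close> gives a preimage of \<open>U\<close> applied to the
  unit vector at \<open>j\<close>. Cancelling \<open>U\<close> leaves that unit vector as
  \<open>SA\<close> applied to some \<open>w\<close>, and its entry at \<open>j\<close> is a product
  equal to 1.\<close>

lemma gsvd_full_rank_diagonal_nonzero: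
  assumes g: "is_gsvd m n A B U V SA SB X" and "vec_space.rank m A = m" and j: "j < m"
  shows "SA $$ (j, j) \<noteq> 0"
proof -
  \<comment> \<open>The columns of \<open>A\<close> live in dimension \<open>m\<close>, so the
    column space is taken there.\<close>
  interpret vec_space "TYPE(real)" m .
  have A: "A \<in> carrier_mat m n" and U: "U \<in> carrier_mat m m" "is_orthogonal U"
    and SA: "SA \<in> carrier_mat m m" "diagonal_mat SA"
    using g unfolding is_gsvd_def by auto
  have "U *\<^sub>v unit_vec m j \<in> col_space A"
    using full_rank_col_space[OF A assms(2)] U(1) by auto
  then obtain x where x: "x \<in> carrier_vec n" "U *\<^sub>v unit_vec m j = A *\<^sub>v x"
    using mem_col_space_iff[OF A] by auto
  obtain u w where uw: "u \<in> carrier_vec (n - m)" "w \<in> carrier_vec m" "x = X *\<^sub>v (u @\<^sub>v w)"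
    using gsvd_coordinates[OF g x(1)] .
  have "U *\<^sub>v unit_vec m j = U *\<^sub>v (SA *\<^sub>v w)"
    using x(2) gsvd_mult_vec(1)[OF g uw(1,2)] uw(3) by simp
  then have "unit_vec m j = SA *\<^sub>v w"
    using is_orthogonal_mult_vec_cancel[OF U] SA(1) uw(2)
    by (metis mult_mat_vec_carrier unit_vec_carrier)
  then have "SA $$ (j, j) * w $ j = 1"
    using diagonal_mult_vec_index[OF SA uw(2) j] j by (metis index_unit_vec(2))
  then show ?thesis by auto
qed

text \<open>Both \<open>U\<close> and \<open>SA\<close> act injectively: \<open>U\<close> is undone
  by its transpose, and \<open>SA\<close> is diagonal without zero entries. The block
  \<open>u\<close> never reaches the image under \<open>A\<close>.\<close>

lemma gsvd_kernel_iff: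
  assumes g: "is_gsvd m n A B U V SA SB X" and "vec_space.rank m A = m"
    and u: "u \<in> carrier_vec (n - m)" and w: "w \<in> carrier_vec m"
  shows "A *\<^sub>v (X *\<^sub>v (u @\<^sub>v w)) = 0\<^sub>v m \<longleftrightarrow> w = 0\<^sub>v m"
proof
  have U: "U \<in> carrier_mat m m" "is_orthogonal U"
    and SA: "SA \<in> carrier_mat m m" "diagonal_mat SA"
    using g unfolding is_gsvd_def by auto
  {
    assume "A *\<^sub>v (X *\<^sub>v (u @\<^sub>v w)) = 0\<^sub>v m"
    then have "U *\<^sub>v (SA *\<^sub>v w) = 0\<^sub>v m" using gsvd_mult_vec(1)[OF g u w] by simp
    then have "SA *\<^sub>v w = 0\<^sub>v m"
      using is_orthogonal_mult_vec_cancel[OF U, of "SA *\<^sub>v w"] SA(1) w U(1)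
        mult_mat_zero_vec[of "transpose_mat U"] by simp
    then have "w $ j = 0" if "j < m" for j
      using diagonal_mult_vec_index[OF SA w that] that
        gsvd_full_rank_diagonal_nonzero[OF g assms(2) that] by simp
    then show "w = 0\<^sub>v m" using w by (intro eq_vecI) auto
  next
    assume "w = 0\<^sub>v m"
    then show "A *\<^sub>v (X *\<^sub>v (u @\<^sub>v w)) = 0\<^sub>v m"
      using gsvd_mult_vec(1)[OF g u w] mult_mat_zero_vec[OF SA(1)]
        mult_mat_zero_vec[OF U(1)] by simp
  }
qed

section \<open>The C-inner product as a Gram product\<close>

lemma C_inner_gram:
  assumes "B \<in> carrier_mat n n" and "inv_mat C = transpose_mat B * B"
    and "x \<in> carrier_vec n" and "y \<in> carrier_vec n"
  shows "C_inner C x y = (B *\<^sub>v x) \<bullet> (B *\<^sub>v y)"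
proof -
  have By: "B *\<^sub>v y \<in> carrier_vec n" using assms by simp
  have "C_inner C x y = x \<bullet> (transpose_mat B *\<^sub>v (B *\<^sub>v y))"
    unfolding C_inner_def assms(2) using assms by simp
  \<comment> \<open>The adjoint rule is applied to the transpose of \<open>B\<close>; the resulting
    double transpose collapses to \<open>B\<close>.\<close>
  also have "\<dots> = (transpose_mat (transpose_mat B) *\<^sub>v x) \<bullet> (B *\<^sub>v y)"
    by (rule transpose_vec_mult_scalar[symmetric]) (use assms in auto)
  finally show ?thesis by simp
qed

text \<open>\<open>B\<close> sends the two vectors to \<open>V\<close> times vectors supported on
  complementary blocks. \<open>V\<close> preserves the Euclidean product, which vanishes there
  because each block pairs a vector with zero.\<close>

lemma gsvd_blocks_C_orthogonal:
  assumes g: "is_gsvd m n A B U V SA SB X" and C: "inv_mat C = transpose_mat B * B"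
    and u: "u \<in> carrier_vec (n - m)" and w: "w \<in> carrier_vec m"
  shows "C_orthogonal C (X *\<^sub>v (u @\<^sub>v 0\<^sub>v m)) (X *\<^sub>v (0\<^sub>v (n - m) @\<^sub>v w))"
proof -
  have carr: "X \<in> carrier_mat n n" "B \<in> carrier_mat n n"
    "V \<in> carrier_mat n n" "is_orthogonal V" "SB \<in> carrier_mat m m" and mn: "n - m + m = n"
    using g unfolding is_gsvd_def by auto
  have app: "a @\<^sub>v b \<in> carrier_vec n" if "a \<in> carrier_vec (n - m)" "b \<in> carrier_vec m"
    for a b :: "real vec"
    using append_carrier_vec[OF that] mn by simp
  have SBw: "SB *\<^sub>v w \<in> carrier_vec m" and SB0: "SB *\<^sub>v 0\<^sub>v m = 0\<^sub>v m" using carr w by auto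
  have "C_inner C (X *\<^sub>v (u @\<^sub>v 0\<^sub>v m)) (X *\<^sub>v (0\<^sub>v (n - m) @\<^sub>v w))
      = (V *\<^sub>v (u @\<^sub>v 0\<^sub>v m)) \<bullet> (V *\<^sub>v (0\<^sub>v (n - m) @\<^sub>v (SB *\<^sub>v w)))"
    using C_inner_gram[OF carr(2) C] gsvd_mult_vec(2)[OF g] app u w carr(1) SB0
    by (metis mult_mat_vec_carrier zero_carrier_vec)
  also have "\<dots> = (u @\<^sub>v 0\<^sub>v m) \<bullet> (0\<^sub>v (n - m) @\<^sub>v (SB *\<^sub>v w))"
    using is_orthogonal_scalar_prod[OF carr(3,4)] app u SBw by simp
  also have "\<dots> = 0"
    using scalar_prod_append[OF u _ _ SBw, of "0\<^sub>v m" "0\<^sub>v (n - m)"] u SBw by simp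
  finally show ?thesis unfolding C_orthogonal_def .
qed

section \<open>The null space and the C-orthogonal splitting\<close>

theorem theorem2p2:
  fixes m n :: nat and A B C U V SA SB X X1 X2 :: "real mat"
  assumes "m < n"
    and "A \<in> carrier_mat m n" and "vec_space.rank m A = m"
    and "sym_pos_def n C"
    and "B \<in> carrier_mat n n" and "inv_mat C = transpose_mat B * B"
    and "is_gsvd m n A B U V SA SB X"
    and "X1 \<in> carrier_mat n (n - m)" and "X2 \<in> carrier_mat n m" and "X = append_cols X1 X2"
  shows "mat_kernel A = vec_space.col_space n X1 \<and>
    C_direct_sum n C (carrier_vec n) (vec_space.col_space n X1) (vec_space.col_space n X2) \<and>
    C_direct_sum n C (carrier_vec n) (mat_kernel A) (vec_space.col_space n X2)"
proof -
  interpret vec_space "TYPE(real)" n .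
  note A = assms(2) and g = assms(7) and X1 = assms(8) and X2 = assms(9)
  have X: "X \<in> carrier_mat n n" "invertible_mat X" using g unfolding is_gsvd_def by auto
  have split: "X *\<^sub>v (u @\<^sub>v w) = X1 *\<^sub>v u + X2 *\<^sub>v w"
    if "u \<in> carrier_vec (n - m)" "w \<in> carrier_vec m" for u w
    using append_cols_mult_append_vec[OF X1 X2 that] assms(10) by simp
  \<comment> \<open>Padding with zeros turns products with \<open>X1\<close> and \<open>X2\<close>
    into products with \<open>X\<close>, so the coordinate lemmas apply to both column
    spaces.\<close>
  have left: "X1 *\<^sub>v u = X *\<^sub>v (u @\<^sub>v 0\<^sub>v m)" if "u \<in> carrier_vec (n - m)" for u
    using split[OF that, of "0\<^sub>v m"] that X1 mult_mat_zero_vec[OF X2] by simp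
  have right: "X2 *\<^sub>v w = X *\<^sub>v (0\<^sub>v (n - m) @\<^sub>v w)" if "w \<in> carrier_vec m" for w
    using split[OF _ that, of "0\<^sub>v (n - m)"] that X2 mult_mat_zero_vec[OF X1] by simp
  note mem1 = mem_col_space_iff[OF X1] and mem2 = mem_col_space_iff[OF X2]
  note sub1 = col_space_is_subspace[OF X1] and sub2 = col_space_is_subspace[OF X2]
  note ker = gsvd_kernel_iff[OF g assms(3)]
  have kernel: "mat_kernel A = col_space X1"
  proof (intro equalityI subsetI)
    fix x assume "x \<in> mat_kernel A"
    then have x: "x \<in> carrier_vec n" "A *\<^sub>v x = 0\<^sub>v m" using mat_kernelD[OF A] by auto
    obtain u w where uw: "u \<in> carrier_vec (n - m)" "w \<in> carrier_vec m" "x = X *\<^sub>v (u @\<^sub>v w)"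
      using gsvd_coordinates[OF g x(1)] .
    then show "x \<in> col_space X1" using ker[OF uw(1,2)] x(2) left mem1 by auto
  next
    fix x assume "x \<in> col_space X1"
    then obtain u where u: "u \<in> carrier_vec (n - m)" "x = X1 *\<^sub>v u" using mem1 by auto
    then have "A *\<^sub>v x = 0\<^sub>v m" using ker[OF u(1), of "0\<^sub>v m"] left by simp
    then show "x \<in> mat_kernel A" using u X1 by (intro mat_kernelI[OF A]) auto
  qed
  have sum: "carrier_vec n = submodule_sum (col_space X1) (col_space X2)"
  proof (intro equalityI subsetI)
    fix x :: "real vec" assume x: "x \<in> carrier_vec n"
    obtain u w where uw: "u \<in> carrier_vec (n - m)" "w \<in> carrier_vec m" "x = X *\<^sub>v (u @\<^sub>v w)"
      using gsvd_coordinates[OF g x] .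
    then show "x \<in> submodule_sum (col_space X1) (col_space X2)"
      unfolding submodule_sum_eq using split mem1 mem2 by blast
  next
    fix x assume "x \<in> submodule_sum (col_space X1) (col_space X2)"
    then show "x \<in> carrier_vec n"
      unfolding submodule_sum_eq using mem1 mem2 X1 X2 by auto
  qed
  \<comment> \<open>A common vector has coordinates (0, w) since it comes from \<open>X2\<close>,
    and it is killed by \<open>A\<close> since the column space of \<open>X1\<close> is the kernel.
    The kernel criterion then forces w = 0.\<close>
  have "x = 0\<^sub>v n" if x: "x \<in> col_space X1" "x \<in> col_space X2" for x
  proof -
    obtain w where w: "w \<in> carrier_vec m" "x = X2 *\<^sub>v w" using x(2) mem2 by auto
    have "A *\<^sub>v x = 0\<^sub>v m" using x(1) kernel mat_kernelD[OF A] by simp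
    then have "w = 0\<^sub>v m" using ker[OF zero_carrier_vec w(1)] right[OF w(1)] w(2) by simp
    then show ?thesis using w(2) mult_mat_zero_vec[OF X2] by simp
  qed
  moreover have "0\<^sub>v n \<in> col_space X1" "0\<^sub>v n \<in> col_space X2"
    using mem1 mem2 mult_mat_zero_vec[OF X1] mult_mat_zero_vec[OF X2]
    by (metis zero_carrier_vec)+
  ultimately have inter: "col_space X1 \<inter> col_space X2 = {0\<^sub>v n}" by blast
  have "C_orthogonal C x y" if x: "x \<in> col_space X1" and y: "y \<in> col_space X2" for x y
  proof -
    obtain u where u: "u \<in> carrier_vec (n - m)" "x = X1 *\<^sub>v u" using x mem1 by auto
    obtain w where w: "w \<in> carrier_vec m" "y = X2 *\<^sub>v w" using y mem2 by auto
    show ?thesis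
      unfolding u(2) w(2) left[OF u(1)] right[OF w(1)]
      using gsvd_blocks_C_orthogonal[OF g assms(6) u(1) w(1)] .
  qed
  then have "C_direct_sum n C (carrier_vec n) (col_space X1) (col_space X2)"
    unfolding C_direct_sum_def using sub1 sub2 sum inter by simp
  \<comment> \<open>Rewriting with the kernel equality turns the first direct sum into the
    second.\<close>
  then show ?thesis using kernel by simp
qed

end
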